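(* Let the sequence $(b_0,b_1,\ldots)$ be defined by $b_0:=0$ and $b_k:=E_{2k-1}(1)$ for $k\ge1$, where $E_j(x)$ are the Euler polynomials. Then for all $n\ge1$, $$H_n(b_k)=(-1)^n\frac{2^{2n+1}}{(2n+1)!}\cdot\mathcal{H}_n\cdot H_n\big(E_{2k+1}(1)\big),\qquad\text{where}\quad \mathcal{H}_n:=\sum_{j=1}^n\frac1j.$$
   Context: For a sequence $(a_k)_{k\ge 0}$ and $n\ge 0$, $H_n(a_k):=\det(a_{i+j})_{0\le i,j\le n}$ denotes the $(n+1)\times(n+1)$ Hankel determinant; thus $H_n(E_{2k+1}(1))$ is the Hankel determinant of the sequence $(E_{2k+1}(1))_{k\ge0}$. The Euler polynomials are defined by $\frac{2e^{xt}}{e^t+1}=\sum_{n\ge0}E_n(x)\frac{t^n}{n!}$. *)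

theory Defs
  imports
    Complex_Main
    "HOL-Computational_Algebra.Formal_Power_Series"
    "Jordan_Normal_Form.Determinant"
begin

definition euler_poly :: "nat \<Rightarrow> real \<Rightarrow> real" where
  "euler_poly n x = fact n * fps_nth (2 * fps_exp x / (fps_exp 1 + 1)) n"

lemma euler_poly_gen_fun:
  "2 * fps_exp x / (fps_exp 1 + 1) = Abs_fps (\<lambda>n. euler_poly n x / fact n)"
  by (rule fps_ext) (simp add: euler_poly_def)

text \<open>The index \<open>n\<close> refers to a matrix of size \<open>(n + 1) \<times> (n + 1)\<close>.\<close>

definition hankel_det :: "nat \<Rightarrow> (nat \<Rightarrow> real) \<Rightarrow> real" where
  "hankel_det n a = det (mat (n + 1) (n + 1) (\<lambda>(i, j). a (i + j)))"

definition b_seq :: "nat \<Rightarrow> real" where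
  "b_seq k = (if k = 0 then 0 else euler_poly (2 * k - 1) 1)"

end

theory Submission
  imports Defs
begin

text \<open>
  Put \<open>T = tanh (t/2)\<close>, so that \<open>E\<^sub>k\<^sub>+\<^sub>1(1)\<close> is the \<open>(k+1)\<close>-st derivative of \<open>T\<close> at \<open>0\<close> and
  \<open>T' = (1 - T\<^sup>2)/2\<close>. Let \<open>q\<^sub>m\<close> be the monic polynomials with
  \<open>q\<^sub>m\<^sub>+\<^sub>1 = x q\<^sub>m + m(m+1)/4 q\<^sub>m\<^sub>-\<^sub>1\<close> (Meixner--Pollaczek, up to rotation of the variable).
  Substituting the derivation \<open>D = d/dt\<close> gives
  \<open>q\<^sub>m(D) T' = K\<^sub>m T\<^sup>m (1 - T\<^sup>2)\<close> for a constant \<open>K\<^sub>m\<close>, which vanishes at \<open>0\<close> for \<open>m > 0\<close>; hence the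
  \<open>q\<^sub>m\<close> are orthogonal for the moments \<open>E\<^sub>k\<^sub>+\<^sub>1(1)\<close>. Replacing the last column of either
  Hankel matrix by the combination of columns given by the even coefficients of \<open>q\<^sub>2\<^sub>n\<close>
  leaves a single nonzero entry there: at the bottom for \<open>E\<^sub>2\<^sub>k\<^sub>+\<^sub>1(1)\<close>, at the top for \<open>b\<^sub>k\<close>.
  Both complementary minors equal the Hankel determinant of \<open>E\<^sub>2\<^sub>k\<^sub>+\<^sub>1(1)\<close> of order one less,
  and the three-term recurrence evaluates the two entries.
\<close>

section \<open>The functional with prescribed moments\<close>

definition moment_functional :: "(nat \<Rightarrow> real) \<Rightarrow> real poly \<Rightarrow> real" where
  "moment_functional f p = (\<Sum>i\<le>degree p. coeff p i * f i)"

lemma moment_functional_eq_sum: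
  assumes "degree p \<le> N"
  shows "moment_functional f p = (\<Sum>i\<le>N. coeff p i * f i)"
  unfolding moment_functional_def
  by (rule sum.mono_neutral_left) (use assms in \<open>auto simp: coeff_eq_0\<close>)

lemma moment_functional_add:
  "moment_functional f (p + q) = moment_functional f p + moment_functional f q"
proof -
  let ?N = "max (degree p) (degree q)"
  have "moment_functional f (p + q) = (\<Sum>i\<le>?N. coeff (p + q) i * f i)"
    by (rule moment_functional_eq_sum) (rule degree_add_le_max)
  also have "\<dots> = moment_functional f p + moment_functional f q"
    by (simp add: moment_functional_eq_sum[of p ?N] moment_functional_eq_sum[of q ?N]
        sum.distrib algebra_simps)
  finally show ?thesis .
qed

lemma moment_functional_smult:
  "moment_functional f (smult c p) = c * moment_functional f p"
  by (simp add: moment_functional_eq_sum[of "smult c p" "degree p"] moment_functional_def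
      sum_distrib_left mult.assoc)

text \<open>Multiplying the polynomial by the variable shifts the moments, so a recurrence for
  polynomials becomes one relating functionals with shifted \<open>f\<close>.\<close>

lemma moment_functional_pCons:
  "moment_functional f (pCons a p) = a * f 0 + moment_functional (\<lambda>i. f (Suc i)) p"
  by (simp add: moment_functional_eq_sum[of "pCons a p" "Suc (degree p)"] degree_pCons_le
      moment_functional_def sum.atMost_Suc_shift del: sum.atMost_Suc)

lemma moment_functional_scale:
  "moment_functional (\<lambda>i. c * f i) p = c * moment_functional f p"
  by (simp add: moment_functional_def sum_distrib_left mult.left_commute)

lemma moment_functional_1: "moment_functional f 1 = f 0"
  by (simp add: moment_functional_def)

section \<open>Orthogonal polynomials for the values of the Euler polynomials at 1\<close>

fun meixner_poly :: "nat \<Rightarrow> real poly" where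
  "meixner_poly 0 = 1"
| "meixner_poly (Suc 0) = [:0, 1:]"
| "meixner_poly (Suc (Suc n)) =
     pCons 0 (meixner_poly (Suc n)) + smult ((real n + 1) * (real n + 2) / 4) (meixner_poly n)"

lemma degree_meixner_poly: "degree (meixner_poly n) \<le> n"
proof (induction n rule: meixner_poly.induct)
  case (3 n)
  have "degree (pCons 0 (meixner_poly (Suc n))) \<le> Suc (Suc n)"
    using 3(1) degree_pCons_le[of 0 "meixner_poly (Suc n)"] by linarith
  moreover have "degree (smult ((real n + 1) * (real n + 2) / 4) (meixner_poly n)) \<le> Suc (Suc n)"
    using 3(2) by (meson degree_smult_le le_Suc_eq order_trans)
  ultimately show ?case
    unfolding meixner_poly.simps by (rule degree_add_le)
qed auto

lemma coeff_meixner_poly_lead: "coeff (meixner_poly n) n = 1"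
proof (induction n rule: meixner_poly.induct)
  case (3 n)
  have "coeff (meixner_poly n) (Suc (Suc n)) = 0"
    using degree_meixner_poly[of n] by (intro coeff_eq_0) linarith
  then show ?case using 3 by simp
qed auto

lemma coeff_meixner_poly_parity: "odd (n + k) \<Longrightarrow> coeff (meixner_poly n) k = 0"
proof (induction n arbitrary: k rule: meixner_poly.induct)
  case 1
  then show ?case by (cases k) auto
next
  case 2
  then show ?case by (cases k) (auto simp: coeff_pCons odd_pos split: nat.splits)
next
  case (3 n)
  then show ?case by (cases k) auto
qed

declare meixner_poly.simps(3) [simp del]

lemma moment_functional_meixner_rec:
  "moment_functional f (meixner_poly (Suc (Suc n))) =
     moment_functional (\<lambda>i. f (Suc i)) (meixner_poly (Suc n))
     + (real n + 1) * (real n + 2) / 4 * moment_functional f (meixner_poly n)"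
  by (simp add: meixner_poly.simps(3) moment_functional_add moment_functional_smult
      moment_functional_pCons)

text \<open>Subtracting 1 makes the series vanish at 0 and leaves all higher coefficients, hence all
  \<open>euler_poly (Suc k) 1\<close>, unchanged.\<close>

definition fps_tanh_half :: "real fps" where
  "fps_tanh_half = 2 * fps_exp 1 / (fps_exp 1 + 1) - 1"

lemma fps_tanh_half_mult: "(fps_tanh_half + 1) * (fps_exp 1 + 1) = 2 * fps_exp 1"
proof -
  have "is_unit (fps_exp 1 + 1 :: real fps)"
    by (simp add: fps_is_unit_iff)
  then show ?thesis
    by (simp add: fps_tanh_half_def)
qed

lemma fps_nth_0_tanh_half: "fps_nth fps_tanh_half 0 = 0"
  using arg_cong[OF fps_tanh_half_mult, of "\<lambda>f. fps_nth f 0"]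
  by (simp add: fps_numeral_nth_0)

lemma fps_deriv_tanh_half: "fps_const 2 * fps_deriv fps_tanh_half = 1 - fps_tanh_half ^ 2"
proof -
  let ?T = fps_tanh_half and ?e = "fps_exp 1 :: real fps"
  have nz: "?e + 1 \<noteq> 0"
  proof
    assume "?e + 1 = 0"
    from arg_cong[OF this, of "\<lambda>f. fps_nth f 0"] show False
      by simp
  qed
  have "fps_deriv ?T * (?e + 1) + (?T + 1) * ?e = 2 * ?e"
    using arg_cong[OF fps_tanh_half_mult, of fps_deriv] by (simp add: algebra_simps)
  then have d: "fps_deriv ?T * (?e + 1) = (1 - ?T) * ?e"
    by (simp add: algebra_simps)
  have "(2 * fps_deriv ?T) * (?e + 1) = (1 - ?T) * (2 * ?e)"
    using arg_cong[OF d, of "\<lambda>f. 2 * f"] by (simp only: mult_ac)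
  \<comment> \<open>Rewriting \<open>2 * ?e\<close> as \<open>(?T + 1) * (?e + 1)\<close> produces
    the factor \<open>1 - ?T ^ 2\<close> and lets \<open>?e + 1\<close> cancel.\<close>
  also have "\<dots> = (1 - ?T ^ 2) * (?e + 1)"
    unfolding fps_tanh_half_mult[symmetric] by (simp add: algebra_simps power2_eq_square)
  finally have "2 * fps_deriv ?T = 1 - ?T ^ 2"
    using nz by simp
  then show ?thesis by (simp add: numeral_fps_const)
qed

lemma fps_nth_deriv_iterate_0: "fps_nth ((fps_deriv ^^ k) f) 0 = fact k * fps_nth f k"
  for f :: "real fps"
proof (induction k arbitrary: f)
  case (Suc k)
  have "fps_nth ((fps_deriv ^^ Suc k) f) 0 = fps_nth ((fps_deriv ^^ k) (fps_deriv f)) 0"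
    by (simp add: funpow_swap1)
  also have "\<dots> = fact (Suc k) * fps_nth f (Suc k)"
    by (subst Suc) simp
  finally show ?case .
qed simp

lemma euler_poly_Suc_1:
  "euler_poly (Suc k) 1 = fps_nth ((fps_deriv ^^ k) (fps_deriv fps_tanh_half)) 0"
  unfolding fps_nth_deriv_iterate_0
  by (simp add: euler_poly_def fps_tanh_half_def)

lemma euler_poly_1_1: "euler_poly (Suc 0) 1 = 1 / 2"
  using arg_cong[OF fps_deriv_tanh_half, of "\<lambda>f. fps_nth f 0"]
  by (simp add: euler_poly_Suc_1 fps_nth_0_tanh_half power2_eq_square)

definition tanh_monomial :: "nat \<Rightarrow> real fps" where
  "tanh_monomial m = fps_tanh_half ^ m * (1 - fps_tanh_half ^ 2)"

lemma fps_deriv_tanh_monomial_0: "fps_deriv (tanh_monomial 0) = - tanh_monomial 1"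
proof -
  have "fps_deriv (tanh_monomial 0) = - (fps_const 2 * fps_deriv fps_tanh_half) * fps_tanh_half"
    by (simp add: tanh_monomial_def power2_eq_square numeral_fps_const[symmetric] algebra_simps)
  then show ?thesis
    unfolding fps_deriv_tanh_half by (simp add: tanh_monomial_def algebra_simps)
qed

text \<open>Differentiation reaches only the two neighbouring powers, mirroring the three-term
  recurrence of \<open>meixner_poly\<close>.\<close>

lemma fps_deriv_tanh_monomial_Suc:
  "2 * fps_deriv (tanh_monomial (Suc m)) =
     of_nat (m + 1) * tanh_monomial m - of_nat (m + 3) * tanh_monomial (Suc (Suc m))"
proof -
  let ?T = fps_tanh_half
  have eq: "tanh_monomial (Suc m) = ?T ^ Suc m - ?T ^ (m + 3)"
    by (simp add: tanh_monomial_def algebra_simps power_add power2_eq_square power3_eq_cube)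
  have "2 * fps_deriv (tanh_monomial (Suc m)) =
      (of_nat (m + 1) * ?T ^ m - of_nat (m + 3) * ?T ^ (m + 2)) * (2 * fps_deriv ?T)"
    unfolding eq fps_deriv_sub fps_deriv_power fps_of_nat by (simp add: algebra_simps)
  also have "2 * fps_deriv ?T = 1 - ?T ^ 2"
    using fps_deriv_tanh_half by (simp add: numeral_fps_const)
  finally show ?thesis
    by (simp add: tanh_monomial_def algebra_simps)
qed

text \<open>The left side is the \<open>k\<close>-th coefficient of the differential operator
  \<open>meixner_poly m\<close> applied to T'. All \<open>k\<close> are treated at once because the
  shift of moments is a derivative, which calls on coefficient \<open>k + 1\<close>.\<close>

lemma moment_functional_meixner_tanh:
  "moment_functional (\<lambda>i. fps_nth ((fps_deriv ^^ i) (fps_deriv fps_tanh_half)) k)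
     (meixner_poly m) = (-1/2) ^ m * fact (Suc m) / 2 * fps_nth (tanh_monomial m) k"
proof (induction m arbitrary: k rule: meixner_poly.induct)
  case 1
  show ?case
    using arg_cong[OF fps_deriv_tanh_half, of "\<lambda>f. fps_nth f k"]
    by (simp add: moment_functional_1 tanh_monomial_def)
next
  case 2
  have "fps_const 2 * fps_deriv (fps_deriv fps_tanh_half) = - tanh_monomial 1"
    using arg_cong[OF fps_deriv_tanh_half, of fps_deriv] fps_deriv_tanh_monomial_0
    by (simp add: tanh_monomial_def)
  from arg_cong[OF this, of "\<lambda>f. fps_nth f k"] show ?case
    by (simp add: moment_functional_pCons moment_functional_def)
next
  case (3 n)
  let ?f = "\<lambda>k i. fps_nth ((fps_deriv ^^ i) (fps_deriv fps_tanh_half)) k"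
  have shift: "?f k (Suc i) = (real k + 1) * ?f (Suc k) i" for i
    by simp
  have "2 * fps_nth (fps_deriv (tanh_monomial (Suc n))) k =
      (real n + 1) * fps_nth (tanh_monomial n) k
      - (real n + 3) * fps_nth (tanh_monomial (Suc (Suc n))) k"
    using arg_cong[OF fps_deriv_tanh_monomial_Suc[of n], of "\<lambda>f. fps_nth f k"]
    by (simp only: fps_sub_nth fps_of_nat[symmetric] numeral_fps_const fps_mult_left_const_nth)
       (simp add: of_nat_add)
  then have d: "(real k + 1) * fps_nth (tanh_monomial (Suc n)) (Suc k) =
      ((real n + 1) * fps_nth (tanh_monomial n) k
      - (real n + 3) * fps_nth (tanh_monomial (Suc (Suc n))) k) / 2"
    by (simp add: add.commute)
  have "moment_functional (?f k) (meixner_poly (Suc (Suc n))) =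
      (real k + 1) * moment_functional (?f (Suc k)) (meixner_poly (Suc n))
      + (real n + 1) * (real n + 2) / 4 * moment_functional (?f k) (meixner_poly n)"
    unfolding moment_functional_meixner_rec shift moment_functional_scale ..
  also have "\<dots> = (-1/2) ^ Suc n * fact (Suc (Suc n)) / 2 *
        ((real k + 1) * fps_nth (tanh_monomial (Suc n)) (Suc k))
      + (real n + 1) * (real n + 2) / 4 *
        ((-1/2) ^ n * fact (Suc n) / 2 * fps_nth (tanh_monomial n) k)"
    unfolding 3 by simp
  \<comment> \<open>The recurrence coefficient is exactly the one for which the
    \<open>tanh_monomial n\<close> terms cancel.\<close>
  also have "\<dots> = (-1/2) ^ Suc (Suc n) * fact (Suc (Suc (Suc n))) / 2 *
      fps_nth (tanh_monomial (Suc (Suc n))) k"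
    unfolding d by (simp add: field_simps)
  finally show ?case .
qed

lemma moment_functional_meixner_euler:
  "moment_functional (\<lambda>i. euler_poly (Suc i) 1) (meixner_poly m) = (if m = 0 then 1 / 2 else 0)"
  unfolding euler_poly_Suc_1 moment_functional_meixner_tanh
  by (simp add: tanh_monomial_def fps_nth_0_tanh_half)

text \<open>Induction on the power \<open>j\<close>: by the recurrence, one factor x is traded for a
  combination of the polynomials of index \<open>m + 1\<close> and \<open>m - 1\<close>, both still
  above \<open>j\<close>.\<close>

lemma meixner_poly_orthogonal:
  "j < m \<Longrightarrow> moment_functional (\<lambda>i. euler_poly (Suc (i + j)) 1) (meixner_poly m) = 0"
proof (induction j arbitrary: m)
  case 0
  then show ?case using moment_functional_meixner_euler[of m] by simp
next
  case (Suc j)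
  then obtain n where m: "m = Suc n" "j < n"
    by (cases m) auto
  show ?case
    using moment_functional_meixner_rec[of "\<lambda>i. euler_poly (Suc (i + j)) 1" n] Suc.IH m
    by simp
qed

text \<open>In the recurrence the polynomial of index \<open>m + 2\<close> drops out by
  orthogonality, leaving the factor -(m+1)(m+2)/4 per step.\<close>

lemma meixner_poly_norm:
  "moment_functional (\<lambda>i. euler_poly (Suc (i + m)) 1) (meixner_poly m) =
     (-1/4) ^ m * fact m * fact (Suc m) / 2"
proof (induction m)
  case 0
  show ?case using moment_functional_meixner_euler[of 0] by simp
next
  case (Suc m)
  have "moment_functional (\<lambda>i. euler_poly (Suc (i + Suc m)) 1) (meixner_poly (Suc m)) =
      - (real m + 1) * (real m + 2) / 4 *
        moment_functional (\<lambda>i. euler_poly (Suc (i + m)) 1) (meixner_poly m)"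
    using moment_functional_meixner_rec[of "\<lambda>i. euler_poly (Suc (i + m)) 1" m]
      meixner_poly_orthogonal[of m "Suc (Suc m)"] by (simp add: field_simps)
  then show ?case
    unfolding Suc by (simp add: field_simps)
qed

section \<open>The functional divided by the square of the variable\<close>

text \<open>Formally the Euler functional divided by x^d, with the undefined moments set to 0; for
  \<open>d = 2\<close> this default provides \<open>b_seq 0 = 0\<close>.\<close>

definition delayed_moments :: "nat \<Rightarrow> nat \<Rightarrow> real" where
  "delayed_moments d k = (if k < d then 0 else euler_poly (Suc (k - d)) 1)"

lemma delayed_moments_Suc: "delayed_moments (Suc d) (Suc i) = delayed_moments d i"
  by (simp add: delayed_moments_def)

lemma moment_functional_delayed_0:
  "moment_functional (delayed_moments 0) (meixner_poly m) = (if m = 0 then 1 / 2 else 0)"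
  using moment_functional_meixner_euler[of m] by (simp add: delayed_moments_def[abs_def])

lemma moment_functional_delayed_1:
  "moment_functional (delayed_moments 1) (meixner_poly (2 * n + 1)) =
     fact (2 * n + 1) / (2 * 4 ^ n)"
proof (induction n)
  case 0
  show ?case
    by (simp add: moment_functional_pCons moment_functional_def delayed_moments_def euler_poly_1_1)
next
  case (Suc n)
  have "moment_functional (delayed_moments 1) (meixner_poly (Suc (Suc (2 * n + 1)))) =
      (real (2 * n + 1) + 1) * (real (2 * n + 1) + 2) / 4 *
        moment_functional (delayed_moments 1) (meixner_poly (2 * n + 1))"
    unfolding moment_functional_meixner_rec One_nat_def delayed_moments_Suc
    by (simp add: moment_functional_delayed_0)
  then show ?case
    unfolding Suc by (simp add: field_simps)
qed

text \<open>The recurrence is inhomogeneous, with the odd-index values for delay 1 as source term.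
  After division by (2n)!/4^n the homogeneous part is constant and the step to n+1 adds 1/(n+1),
  whence the harmonic number.\<close>

lemma moment_functional_delayed_2:
  "moment_functional (delayed_moments 2) (meixner_poly (2 * n)) =
     fact (2 * n) / 4 ^ n * (\<Sum>j = 1..n. 1 / real j)"
proof (induction n)
  case 0
  show ?case by (simp add: moment_functional_1 delayed_moments_def)
next
  case (Suc n)
  let ?H = "\<Sum>j = 1..n. 1 / real j"
  have "moment_functional (delayed_moments 2) (meixner_poly (Suc (Suc (2 * n)))) =
      moment_functional (delayed_moments 1) (meixner_poly (2 * n + 1))
      + (real (2 * n) + 1) * (real (2 * n) + 2) / 4 *
        moment_functional (delayed_moments 2) (meixner_poly (2 * n))"
    unfolding moment_functional_meixner_rec numeral_2_eq_2 delayed_moments_Suc by simp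
  also have "\<dots> = fact (2 * n + 1) / (2 * 4 ^ n)
      + (real (2 * n) + 1) * (real (2 * n) + 2) / 4 * (fact (2 * n) / 4 ^ n * ?H)"
    unfolding Suc moment_functional_delayed_1 ..
  also have "\<dots> = fact (2 * Suc n) / 4 ^ Suc n * (?H + 1 / real (Suc n))"
  proof -
    have f1: "fact (2 * n + 1) = (2 * real n + 1) * fact (2 * n)"
      and f2: "fact (2 * Suc n) = (2 * real n + 2) * (2 * real n + 1) * fact (2 * n)"
      by (simp_all add: algebra_simps)
    show ?thesis
      unfolding f1 f2 power_Suc of_nat_Suc by (simp add: divide_simps) (simp add: algebra_simps)
  qed
  finally show ?case by simp
qed

section \<open>Hankel determinants\<close>

lemma moment_functional_meixner_even:
  "moment_functional f (meixner_poly (2 * n)) =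
     (\<Sum>i\<le>n. coeff (meixner_poly (2 * n)) (2 * i) * f (2 * i))"
proof -
  have "moment_functional f (meixner_poly (2 * n)) =
      (\<Sum>k\<le>2 * n. coeff (meixner_poly (2 * n)) k * f k)"
    by (rule moment_functional_eq_sum[OF degree_meixner_poly])
  also have "\<dots> = (\<Sum>k\<in>(\<lambda>i. 2 * i) ` {..n}. coeff (meixner_poly (2 * n)) k * f k)"
  proof (rule sum.mono_neutral_right; safe?)
    fix k assume "k \<le> 2 * n" and k: "k \<notin> (*) 2 ` {..n}"
    then have "odd k"
      by (auto elim!: evenE)
    then show "coeff (meixner_poly (2 * n)) k * f k = 0"
      by (simp add: coeff_meixner_poly_parity)
  qed auto
  also have "\<dots> = (\<Sum>i\<le>n. coeff (meixner_poly (2 * n)) (2 * i) * f (2 * i))"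
    by (subst sum.reindex) (auto simp: inj_on_def)
  finally show ?thesis .
qed

lemma hankel_det_single_entry:
  fixes a v :: "nat \<Rightarrow> real"
  assumes "v n = 1" and "k \<le> n"
    and "\<And>j. j \<le> n \<Longrightarrow> (\<Sum>i\<le>n. v i * a (i + j)) = (if j = k then h else 0)"
  shows "hankel_det n a =
    h * (-1) ^ (k + n) * det (mat_delete (mat (n + 1) (n + 1) (\<lambda>(i, j). a (i + j))) k n)"
proof -
  let ?A = "mat (n + 1) (n + 1) (\<lambda>(i, j). a (i + j))"
  let ?x = "vec (n + 1) v"
  let ?B = "replace_col ?A (?A *\<^sub>v ?x) n"
  have B: "?B \<in> carrier_mat (n + 1) (n + 1)"
    by (simp add: replace_col_def)
  have entry: "?B $$ (j, n) = (if j = k then h else 0)" if "j \<le> n" for j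
    using that assms(3)[OF that]
    by (simp add: replace_col_def scalar_prod_def atLeast0LessThan lessThan_Suc_atMost
        mult.commute add.commute)
  have del: "mat_delete ?B k n = mat_delete ?A k n"
    by (rule eq_matI) (auto simp: mat_delete_def replace_col_def)
  \<comment> \<open>By Cramer's rule the replaced column scales the determinant by the last entry of
    \<open>?x\<close>, which is 1.\<close>
  have "hankel_det n a = det ?B"
    using cramer_lemma_mat[of ?A "n + 1" ?x n] assms(1) by (simp add: hankel_det_def)
  also have "\<dots> = (\<Sum>i<n + 1. ?B $$ (i, n) * cofactor ?B i n)"
    by (rule laplace_expansion_column[OF B]) simp
  also have "\<dots> = (\<Sum>i<n + 1. if i = k then h * cofactor ?B k n else 0)"
  proof (rule sum.cong)
    fix i assume "i \<in> {..<n + 1}"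
    then have "i \<le> n" by simp
    from entry[OF this]
    show "?B $$ (i, n) * cofactor ?B i n = (if i = k then h * cofactor ?B k n else 0)"
      by (simp only: mult_zero_left split: if_split) simp
  qed simp
  also have "\<dots> = h * cofactor ?B k n"
    using assms(2) by (simp add: sum.delta)
  finally show ?thesis
    unfolding cofactor_def del by simp
qed

lemma hankel_det_euler_Suc:
  "hankel_det (Suc n) (\<lambda>k. euler_poly (2 * k + 1) 1) =
     fact (2 * Suc n) * fact (2 * Suc n + 1) / (2 * 16 ^ Suc n)
     * hankel_det n (\<lambda>k. euler_poly (2 * k + 1) 1)"
proof -
  let ?v = "\<lambda>i. coeff (meixner_poly (2 * Suc n)) (2 * i)"
  have "(\<Sum>i\<le>Suc n. ?v i * euler_poly (2 * (i + j) + 1) 1) =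
      (if j = Suc n then fact (2 * Suc n) * fact (2 * Suc n + 1) / (2 * 16 ^ Suc n) else 0)"
    if "j \<le> Suc n" for j
  proof -
    \<comment> \<open>Row \<open>j\<close> pairs x^(2j) with the polynomial of index
      \<open>2 * Suc n\<close>: orthogonality kills every row but the last, which gives the
      norm.\<close>
    have "(\<Sum>i\<le>Suc n. ?v i * euler_poly (2 * (i + j) + 1) 1) =
        moment_functional (\<lambda>i. euler_poly (Suc (i + 2 * j)) 1) (meixner_poly (2 * Suc n))"
      unfolding moment_functional_meixner_even by simp
    also have "\<dots> = (if j = Suc n
        then (-1/4) ^ (2 * Suc n) * fact (2 * Suc n) * fact (Suc (2 * Suc n)) / 2 else 0)"
      using that meixner_poly_orthogonal[of "2 * j" "2 * Suc n"] meixner_poly_norm[of "2 * Suc n"]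
      by (cases "j = Suc n") auto
    also have "(-1/4 :: real) ^ (2 * Suc n) = 1 / 16 ^ Suc n"
      unfolding power_mult by (simp add: power_divide power2_eq_square)
    finally show ?thesis by simp
  qed
  from hankel_det_single_entry[where v = ?v and k = "Suc n", OF coeff_meixner_poly_lead _ this]
  have "hankel_det (Suc n) (\<lambda>k. euler_poly (2 * k + 1) 1) =
     fact (2 * Suc n) * fact (2 * Suc n + 1) / (2 * 16 ^ Suc n) *
     det (mat_delete (mat (Suc n + 1) (Suc n + 1) (\<lambda>(i, j). euler_poly (2 * (i + j) + 1) 1))
       (Suc n) (Suc n))"
    by simp
  also have "mat_delete (mat (Suc n + 1) (Suc n + 1) (\<lambda>(i, j). euler_poly (2 * (i + j) + 1) 1))
       (Suc n) (Suc n) = mat (n + 1) (n + 1) (\<lambda>(i, j). euler_poly (2 * (i + j) + 1) 1)"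
    by (rule eq_matI) (auto simp: mat_delete_def)
  finally show ?thesis
    by (simp add: hankel_det_def)
qed

lemma hankel_det_b_seq_Suc:
  "hankel_det (Suc n) b_seq =
     (-1) ^ Suc n * (fact (2 * Suc n) / 4 ^ Suc n * (\<Sum>j = 1..Suc n. 1 / real j))
     * hankel_det n (\<lambda>k. euler_poly (2 * k + 1) 1)"
proof -
  let ?v = "\<lambda>i. coeff (meixner_poly (2 * Suc n)) (2 * i)"
  let ?h = "fact (2 * Suc n) / 4 ^ Suc n * (\<Sum>j = 1..Suc n. 1 / real j)"
  have "(\<Sum>i\<le>Suc n. ?v i * b_seq (i + j)) = (if j = 0 then ?h else 0)" if "j \<le> Suc n" for j
  proof (cases j)
    case 0
    have "delayed_moments 2 (2 * i) = b_seq i" for i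
      by (cases i) (auto simp: delayed_moments_def b_seq_def)
    then show ?thesis
      using 0 moment_functional_delayed_2[of "Suc n"]
      unfolding moment_functional_meixner_even by simp
  next
    case (Suc l)
    \<comment> \<open>Below the top row \<open>b_seq 0\<close> never occurs, so these rows are
      ordinary orthogonality relations with x^(2l), where l = j - 1.\<close>
    have "b_seq (i + j) = euler_poly (Suc (2 * i + 2 * l)) 1" for i
      by (simp add: b_seq_def Suc)
    then show ?thesis
      using Suc that meixner_poly_orthogonal[of "2 * l" "2 * Suc n"]
      unfolding moment_functional_meixner_even by simp
  qed
  from hankel_det_single_entry[where v = ?v and k = 0, OF coeff_meixner_poly_lead _ this]
  have "hankel_det (Suc n) b_seq = ?h * (-1) ^ Suc n *
     det (mat_delete (mat (Suc n + 1) (Suc n + 1) (\<lambda>(i, j). b_seq (i + j))) 0 (Suc n))"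
    by simp
  \<comment> \<open>Deleting the top row raises the index by one, and \<open>b_seq (k + 1)\<close>
    is \<open>euler_poly (2 * k + 1) 1\<close>.\<close>
  also have "mat_delete (mat (Suc n + 1) (Suc n + 1) (\<lambda>(i, j). b_seq (i + j))) 0 (Suc n) =
      mat (n + 1) (n + 1) (\<lambda>(i, j). euler_poly (2 * (i + j) + 1) 1)"
    by (rule eq_matI) (auto simp: mat_delete_def b_seq_def)
  finally show ?thesis
    by (simp add: hankel_det_def)
qed

theorem proposition3p3:
  fixes n :: nat
  assumes "n \<ge> 1"
  shows "hankel_det n b_seq =
    (-1) ^ n * (2 ^ (2 * n + 1) / fact (2 * n + 1)) * (\<Sum>j = 1..n. 1 / real j)
      * hankel_det n (\<lambda>k. euler_poly (2 * k + 1) 1)"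
proof -
  obtain m where n: "n = Suc m"
    using assms by (cases n) auto
  \<comment> \<open>The claimed constant times the norm equals the factor in the top entry, so the
    common minor of order \<open>m\<close> never has to be divided out.\<close>
  have "(2 ^ (2 * n + 1) / fact (2 * n + 1)) *
      (fact (2 * n) * fact (2 * n + 1) / (2 * 16 ^ n)) = (4 ^ n / 16 ^ n) * (fact (2 * n) :: real)"
    by (simp add: power_mult del: fact_Suc)
  also have "(4 ^ n / 16 ^ n :: real) = 1 / 4 ^ n"
    by (simp flip: power_divide add: power_one_over)
  finally have e: "(2 ^ (2 * n + 1) / fact (2 * n + 1)) *
      (fact (2 * n) * fact (2 * n + 1) / (2 * 16 ^ n)) = (fact (2 * n) / 4 ^ n :: real)"
    by simp
  have "hankel_det n b_seq = (-1) ^ n * (fact (2 * n) / 4 ^ n * (\<Sum>j = 1..n. 1 / real j))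
      * hankel_det m (\<lambda>k. euler_poly (2 * k + 1) 1)"
    unfolding n by (rule hankel_det_b_seq_Suc)
  also have "\<dots> = (-1) ^ n * (2 ^ (2 * n + 1) / fact (2 * n + 1)) * (\<Sum>j = 1..n. 1 / real j)
      * (fact (2 * n) * fact (2 * n + 1) / (2 * 16 ^ n)
      * hankel_det m (\<lambda>k. euler_poly (2 * k + 1) 1))"
    unfolding e[symmetric] by (simp only: mult_ac)
  also have "fact (2 * n) * fact (2 * n + 1) / (2 * 16 ^ n)
      * hankel_det m (\<lambda>k. euler_poly (2 * k + 1) 1) =
      hankel_det n (\<lambda>k. euler_poly (2 * k + 1) 1)"
    unfolding n by (rule hankel_det_euler_Suc[symmetric])
  finally show ?thesis .
qed

end
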